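(* Let $p$ be a prime and let $G=\mathbb{Z}_{p^{\alpha_1}}\times\mathbb{Z}_{p^{\alpha_2}}\times\cdots\times\mathbb{Z}_{p^{\alpha_k}}$ be a finite abelian $p$-group, where $k\geq 1$ and $1\leq\alpha_1\leq\alpha_2\leq\cdots\leq\alpha_k$. (a) If $\alpha_1>1$, then the only isolated subgroups of $G$ are $1$ and $G$. (b) If $1=\alpha_1=\alpha_2=\cdots=\alpha_r<\alpha_{r+1}\leq\cdots\leq\alpha_k$ for some $1\leq r\leq k$, and $A=\mathbb{Z}_{p^{\alpha_{r+1}}}\times\cdots\times\mathbb{Z}_{p^{\alpha_k}}$, regarded as a subgroup of $G$, then the isolated subgroups of $G$ are exactly $G$ itself and all subgroups $H\leq G$ with $H\cap A=1$.
   Context: A subgroup $H$ of a finite group $G$ is called isolated in $G$ if for every $x\in G$ we have either $x\in H$ or $\langle x\rangle\cap H=1$, where $\langle x\rangle$ is the cyclic subgroup generated by $x$ and $1$ denotes the trivial subgroup. $\mathbb{Z}_n$ denotes the cyclic group of order $n$. In (b), $A$ is identified with the subgroup of $G$ consisting of the elements whose first $r$ coordinates are trivial; when $r=k$ (that is, $G$ is elementary abelian), $A$ is the trivial subgroup. *)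

theory Defs
  imports "HOL-Algebra.Product_Groups" "HOL-Computational_Algebra.Primes"
begin

definition isolated_subgroup :: "'a set \<Rightarrow> ('a, 'b) monoid_scheme \<Rightarrow> bool" where
  "isolated_subgroup H G \<longleftrightarrow>
     subgroup H G \<and> (\<forall>x\<in>carrier G. x \<in> H \<or> generate G {x} \<inter> H = {\<one>\<^bsub>G\<^esub>})"

(* Factors are indexed from 1 to k; elements are functions that are undefined off {1..k}. *)
definition abelian_p_group :: "nat \<Rightarrow> nat \<Rightarrow> (nat \<Rightarrow> nat) \<Rightarrow> (nat \<Rightarrow> int) monoid" where
  "abelian_p_group p k \<alpha> = product_group {1..k} (\<lambda>i. integer_mod_group (p ^ \<alpha> i))"

(* The product of the factors r+1, ..., k, embedded in the full product by padding with
   identity elements; for r = k it is the trivial subgroup. *)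
definition tail_factor :: "nat \<Rightarrow> nat \<Rightarrow> (nat \<Rightarrow> nat) \<Rightarrow> nat \<Rightarrow> (nat \<Rightarrow> int) set" where
  "tail_factor p k \<alpha> r =
     {x \<in> carrier (abelian_p_group p k \<alpha>). \<forall>i\<in>{1..r}. x i = \<one>\<^bsub>integer_mod_group (p ^ \<alpha> i)\<^esub>}"

end

theory Submission
  imports Defs
begin

text \<open>
  Let \<open>A\<close> be a subgroup of an abelian \<open>p\<close>-group that contains all \<open>p\<close>-th powers and in which every
  element of order \<open>p\<close> is a \<open>p\<close>-th power. If \<open>H\<close> is isolated and meets \<open>A\<close> nontrivially, then some
  \<open>1 \<noteq> h \<in> H \<inter> A\<close> has the form \<open>y ^ p\<close>, and isolation gives \<open>y \<in> H\<close>. For \<open>x\<close> with \<open>x ^ p = 1\<close>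
  also \<open>(x y) ^ p = h\<close>, so \<open>x y \<in> H\<close> and hence \<open>x \<in> H\<close>. Every nontrivial element has a nontrivial
  power of order \<open>p\<close>, which lies in \<open>H\<close>, so \<open>H\<close> is the whole group. Conversely, if \<open>H \<inter> A = 1\<close>
  and \<open>x ^ m \<in> H\<close>, then \<open>x ^ m \<in> H \<inter> A = 1\<close> when \<open>p\<close> divides \<open>m\<close>, while otherwise \<open>x\<close> is a power
  of \<open>x ^ m\<close> and lies in \<open>H\<close>. Both parts of the theorem are instances of this, with \<open>r = 0\<close> in (a).
\<close>

section \<open>Powers, roots and isolated subgroups in abstract groups\<close>

lemma (in group) subgroup_nat_pow_closed:
  assumes "subgroup H G" "x \<in> H"
  shows "x [^] (n::nat) \<in> H"
  using assms by (induction n) (auto intro: subgroup.m_closed subgroup.one_closed)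

text \<open>By Bezout, \<open>u * m + v * int n = 1\<close>, so \<open>x\<close> is the
  \<open>u\<close>-th power of \<open>x [^] m\<close> times a power of \<open>x [^] n\<close>, which
  is trivial.\<close>

lemma (in group) mem_subgroup_if_coprime_pow_mem:
  fixes m :: int and n :: nat
  assumes H: "subgroup H G" and x: "x \<in> carrier G" "x [^] n = \<one>"
    and m: "coprime m (int n)" "x [^] m \<in> H"
  shows "x \<in> H"
proof -
  obtain u v where uv: "u * m + v * int n = 1"
    using m(1) bezout_int[of m "int n"] by (auto simp: coprime_iff_gcd_eq_1)
  have "x = x [^] (m * u + int n * v)"
    using uv x by (simp add: mult.commute)
  also have "\<dots> = (x [^] m) [^] u \<otimes> (x [^] n) [^] v"
    using x(1) by (simp add: int_pow_mult int_pow_pow flip: int_pow_int)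
  also have "\<dots> = (x [^] m) [^] u"
    using x by simp
  also have "\<dots> \<in> H"
    using H m(2) by (rule subgroup_int_pow_closed)
  finally show ?thesis .
qed

text \<open>The sequence of iterated \<open>p\<close>-th powers of \<open>x\<close> starts away from
  the identity and reaches it; its last nontrivial term is the required power.\<close>

lemma (in group) exists_nontrivial_pow_killed:
  fixes p n :: nat
  assumes "x \<in> carrier G" "x \<noteq> \<one>" "x [^] (p ^ n) = \<one>"
  shows "\<exists>q::nat. x [^] q \<noteq> \<one> \<and> (x [^] q) [^] p = \<one>"
  using assms(3)
proof (induction n)
  case 0
  then show ?case using assms by simp
next
  case (Suc n)
  show ?case
  proof (cases "x [^] (p ^ n) = \<one>")
    case False
    moreover have "(x [^] (p ^ n)) [^] p = \<one>"
      using Suc.prems assms(1) by (simp add: nat_pow_pow mult.commute)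
    ultimately show ?thesis by blast
  qed (rule Suc.IH)
qed

text \<open>A root \<open>x\<close> outside \<open>H\<close> would put the nontrivial
  \<open>x [^] n\<close> into both \<open>H\<close> and \<open>generate G {x}\<close>. Isolation is
  used below only in this form, as closure under roots of nontrivial elements.\<close>

lemma (in group) isolated_subgroupD:
  fixes n :: nat
  assumes "isolated_subgroup H G" "x \<in> carrier G" "x [^] n \<in> H" "x [^] n \<noteq> \<one>"
  shows "x \<in> H"
proof (rule ccontr)
  assume "x \<notin> H"
  then have "generate G {x} \<inter> H = {\<one>}"
    using assms(1,2) by (auto simp: isolated_subgroup_def)
  moreover have "x [^] n \<in> generate G {x}"
    unfolding generate_pow[OF assms(2)] by (auto intro!: exI[of _ "int n"] simp: int_pow_int)
  ultimately show False
    using assms(3,4) by blast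
qed

lemma (in group) isolated_subgroup_carrier: "isolated_subgroup (carrier G) G"
  by (simp add: isolated_subgroup_def subgroup_self)

lemma (in comm_group) isolated_meets_imp_carrier:
  fixes p n :: nat
  assumes exponent: "\<And>x. x \<in> carrier G \<Longrightarrow> x [^] (p ^ n) = \<one>"
    and A: "subgroup A G"
    and root: "\<And>x. x \<in> A \<Longrightarrow> x [^] p = \<one> \<Longrightarrow> \<exists>y\<in>carrier G. y [^] p = x"
    and H: "isolated_subgroup H G"
    and meets: "H \<inter> A \<noteq> {\<one>}"
  shows "H = carrier G"
proof -
  have sub: "subgroup H G"
    using H by (simp add: isolated_subgroup_def)
  obtain h where h: "h \<in> H" "h \<in> A" "h \<noteq> \<one>"
    using meets subgroup.one_closed[OF sub] subgroup.one_closed[OF A] by auto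
  \<comment> \<open>The assumption \<open>root\<close> applies only to elements killed by
    \<open>p\<close>, so \<open>h\<close> is replaced by such a power, which stays in both
    \<open>H\<close> and \<open>A\<close>.\<close>
  obtain q :: nat where q: "h [^] q \<noteq> \<one>" "(h [^] q) [^] p = \<one>"
    using exists_nontrivial_pow_killed exponent h subgroup.mem_carrier[OF A] by metis
  have hq: "h [^] q \<in> H" "h [^] q \<in> A"
    using h sub A by (auto intro: subgroup_nat_pow_closed)
  then obtain y where y: "y \<in> carrier G" "y [^] p = h [^] q"
    using root q(2) by blast
  have yH: "y \<in> H"
    using isolated_subgroupD[OF H y(1), of p] y(2) hq(1) q(1) by simp
  have socle: "x \<in> H" if x: "x \<in> carrier G" "x [^] p = \<one>" for x
  proof -
    have "(x \<otimes> y) [^] p = h [^] q"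
      using x y h(1) subgroup.mem_carrier[OF sub] by (simp add: nat_pow_distrib)
    then have "x \<otimes> y \<in> H"
      using isolated_subgroupD[OF H, of "x \<otimes> y" p] x y hq(1) q(1) by simp
    then have "(x \<otimes> y) \<otimes> inv y \<in> H"
      using yH sub by (auto intro: subgroup.m_closed subgroup.m_inv_closed)
    then show ?thesis
      using x y by (simp add: m_assoc)
  qed
  have "x \<in> H" if x: "x \<in> carrier G" for x
  proof (cases "x = \<one>")
    case True
    then show ?thesis using subgroup.one_closed[OF sub] by simp
  next
    case False
    then obtain q :: nat where "x [^] q \<noteq> \<one>" "(x [^] q) [^] p = \<one>"
      using exists_nontrivial_pow_killed[OF x] exponent[OF x] by blast
    then show ?thesis
      using isolated_subgroupD[OF H x] socle x by blast
  qed
  then show ?thesis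
    using subgroup.subset[OF sub] by blast
qed

lemma (in group) isolated_if_trivial_inter:
  fixes p n :: nat
  assumes "Factorial_Ring.prime p"
    and exponent: "\<And>x. x \<in> carrier G \<Longrightarrow> x [^] (p ^ n) = \<one>"
    and powers: "\<And>x. x \<in> carrier G \<Longrightarrow> x [^] p \<in> A"
    and H: "subgroup H G"
    and trivial: "H \<inter> A = {\<one>}"
  shows "isolated_subgroup H G"
  unfolding isolated_subgroup_def
proof (intro conjI H ballI disjCI)
  fix x assume x: "x \<in> carrier G" and "generate G {x} \<inter> H \<noteq> {\<one>}"
  moreover have "\<one> \<in> generate G {x} \<inter> H"
    using subgroup.one_closed[OF H] generate.one by blast
  ultimately obtain m :: int where m: "x [^] m \<in> H" "x [^] m \<noteq> \<one>"
    unfolding generate_pow[OF x] by blast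
  have "\<not> int p dvd m"
  proof
    assume "int p dvd m"
    then obtain l where "m = l * int p"
      by (metis dvd_def mult.commute)
    then have "x [^] m = (x [^] l) [^] p"
      using x by (simp add: int_pow_pow flip: int_pow_int)
    then have "x [^] m \<in> A"
      using powers x by simp
    then show False
      using m trivial by blast
  qed
  \<comment> \<open>As \<open>p\<close> is prime, not being divisible by \<open>p\<close> means
    being coprime to every power of \<open>p\<close>, in particular to the exponent
    \<open>p ^ n\<close>.\<close>
  then have "coprime m (int (p ^ n))"
    using prime_imp_coprime[of "int p" m] assms(1) by (simp add: coprime_commute)
  then show "x \<in> H"
    using mem_subgroup_if_coprime_pow_mem[OF H x exponent[OF x]] m(1) by blast
qed

text \<open>The existence of roots in \<open>A\<close> gives the inclusion from left to right; that
  \<open>A\<close> contains all \<open>p\<close>-th powers gives the converse.\<close>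

lemma (in comm_group) isolated_subgroups_eq:
  fixes p n :: nat
  assumes "Factorial_Ring.prime p"
    and "\<And>x. x \<in> carrier G \<Longrightarrow> x [^] (p ^ n) = \<one>"
    and "subgroup A G"
    and "\<And>x. x \<in> carrier G \<Longrightarrow> x [^] p \<in> A"
    and "\<And>x. x \<in> A \<Longrightarrow> x [^] p = \<one> \<Longrightarrow> \<exists>y\<in>carrier G. y [^] p = x"
  shows "{H. isolated_subgroup H G} = {carrier G} \<union> {H. subgroup H G \<and> H \<inter> A = {\<one>}}"
proof (intro equalityI subsetI)
  fix H assume "H \<in> {H. isolated_subgroup H G}"
  then have H: "isolated_subgroup H G" by simp
  then have "subgroup H G" by (simp add: isolated_subgroup_def)
  moreover have "H \<inter> A = {\<one>} \<or> H = carrier G"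
    using isolated_meets_imp_carrier[OF assms(2,3,5) H] by blast
  ultimately show "H \<in> {carrier G} \<union> {H. subgroup H G \<and> H \<inter> A = {\<one>}}"
    by blast
next
  fix H assume "H \<in> {carrier G} \<union> {H. subgroup H G \<and> H \<inter> A = {\<one>}}"
  then show "H \<in> {H. isolated_subgroup H G}"
    using isolated_subgroup_carrier isolated_if_trivial_inter[OF assms(1,2,4)] by blast
qed

section \<open>Coordinatewise arithmetic in products of cyclic groups\<close>

lemma comm_group_product_group:
  assumes "\<And>i. i \<in> I \<Longrightarrow> comm_group (G i)"
  shows "comm_group (product_group I G)"
proof (rule group.group_comm_groupI)
  show "group (product_group I G)"
    using assms by (simp add: comm_group.axioms(2))
next
  fix x y assume "x \<in> carrier (product_group I G)" "y \<in> carrier (product_group I G)"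
  then show "x \<otimes>\<^bsub>product_group I G\<^esub> y = y \<otimes>\<^bsub>product_group I G\<^esub> x"
    by (auto simp: PiE_iff intro!: restrict_ext comm_monoid.m_comm comm_group.axioms(1) assms)
qed

lemma nat_pow_product_group:
  fixes n :: nat
  shows "x [^]\<^bsub>product_group I G\<^esub> n = (\<lambda>i\<in>I. x i [^]\<^bsub>G i\<^esub> n)"
  by (induction n) (auto intro: restrict_ext)

lemma comm_group_abelian_p_group: "comm_group (abelian_p_group p k \<alpha>)"
  by (simp add: abelian_p_group_def comm_group_product_group)

lemma one_abelian_p_group: "\<one>\<^bsub>abelian_p_group p k \<alpha>\<^esub> = (\<lambda>i\<in>{1..k}. 0)"
  by (simp add: abelian_p_group_def)

lemma nat_pow_abelian_p_group:
  fixes n :: nat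
  shows "x [^]\<^bsub>abelian_p_group p k \<alpha>\<^esub> n = (\<lambda>i\<in>{1..k}. int n * x i mod int (p ^ \<alpha> i))"
  by (simp add: abelian_p_group_def nat_pow_product_group)

lemma carrier_abelian_p_group:
  assumes "p > 0"
  shows "carrier (abelian_p_group p k \<alpha>) = (\<Pi>\<^sub>E i\<in>{1..k}. {0..<int (p ^ \<alpha> i)})"
  using assms by (simp add: abelian_p_group_def carrier_integer_mod_group)

text \<open>The sum of the \<open>\<alpha> i\<close> bounds each of them, so this power of
  \<open>p\<close> is a multiple of the order of every factor.\<close>

lemma exponent_abelian_p_group:
  "x [^]\<^bsub>abelian_p_group p k \<alpha>\<^esub> (p ^ (\<Sum>i=1..k. \<alpha> i)) = \<one>\<^bsub>abelian_p_group p k \<alpha>\<^esub>"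
proof -
  have "int p ^ \<alpha> i dvd int p ^ (\<Sum>i=1..k. \<alpha> i)" if "i \<in> {1..k}" for i
    using that by (intro le_imp_power_dvd member_le_sum) auto
  then show ?thesis
    by (auto simp: nat_pow_abelian_p_group one_abelian_p_group intro!: restrict_ext)
qed

lemma subgroup_tail_factor:
  assumes "r \<le> k"
  shows "subgroup (tail_factor p k \<alpha> r) (abelian_p_group p k \<alpha>)"
proof -
  let ?Z = "\<lambda>i. integer_mod_group (p ^ \<alpha> i)"
  \<comment> \<open>The tail factor is rewritten as a product of one subgroup per coordinate:
    trivial up to \<open>r\<close>, full afterwards.\<close>
  let ?B = "\<lambda>i. if i \<le> r then {\<one>\<^bsub>?Z i\<^esub>} else carrier (?Z i)"
  have "x \<in> tail_factor p k \<alpha> r \<longleftrightarrow> x \<in> PiE {1..k} ?B" for x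
    using assms by (force simp: tail_factor_def abelian_p_group_def PiE_iff)
  then have "tail_factor p k \<alpha> r = PiE {1..k} ?B"
    by blast
  moreover have "subgroup (?B i) (?Z i)" for i
    using group.triv_subgroup[OF group_integer_mod_group, of "p ^ \<alpha> i"]
    by (simp add: group.subgroup_self)
  then have "subgroup (PiE {1..k} ?B) (product_group {1..k} ?Z)"
    by (subst PiE_subgroup_product_group) (rule group_integer_mod_group, rule ballI)
  ultimately show ?thesis
    by (simp only: abelian_p_group_def)
qed

text \<open>The first \<open>r\<close> factors have order \<open>p\<close>, so a \<open>p\<close>-th
  power vanishes in those coordinates.\<close>

lemma pow_mem_tail_factor:
  assumes "r \<le> k" "\<And>i. i \<in> {1..r} \<Longrightarrow> \<alpha> i = 1" "x \<in> carrier (abelian_p_group p k \<alpha>)"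
  shows "x [^]\<^bsub>abelian_p_group p k \<alpha>\<^esub> p \<in> tail_factor p k \<alpha> r"
proof -
  interpret comm_group "abelian_p_group p k \<alpha>"
    by (rule comm_group_abelian_p_group)
  have "x [^]\<^bsub>abelian_p_group p k \<alpha>\<^esub> p \<in> carrier (abelian_p_group p k \<alpha>)"
    using assms(3) by simp
  then show ?thesis
    using assms(1,2) by (auto simp: tail_factor_def nat_pow_abelian_p_group)
qed

lemma tail_factor_root:
  assumes "p > 0" and tail: "\<And>i. r < i \<Longrightarrow> i \<le> k \<Longrightarrow> 1 < \<alpha> i"
    and x: "x \<in> tail_factor p k \<alpha> r"
    and ord: "x [^]\<^bsub>abelian_p_group p k \<alpha>\<^esub> p = \<one>\<^bsub>abelian_p_group p k \<alpha>\<^esub>"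
  shows "\<exists>y\<in>carrier (abelian_p_group p k \<alpha>). y [^]\<^bsub>abelian_p_group p k \<alpha>\<^esub> p = x"
proof -
  \<comment> \<open>The root divides the integer representatives by \<open>p\<close>. The division
    is exact: coordinates up to \<open>r\<close> are 0, and beyond \<open>r\<close> the modulus is
    divisible by the square of \<open>p\<close>, so \<open>p * x i\<close> being 0 modulo it forces
    \<open>p\<close> to divide \<open>x i\<close>.\<close>
  let ?y = "\<lambda>i\<in>{1..k}. x i div int p"
  have xc: "x \<in> (\<Pi>\<^sub>E i\<in>{1..k}. {0..<int (p ^ \<alpha> i)})"
    using x assms(1) by (simp add: tail_factor_def carrier_abelian_p_group)
  have dvd: "int p dvd x i" if i: "i \<in> {1..k}" for i
  proof (cases "i \<le> r")
    case True
    then show ?thesis using x i by (simp add: tail_factor_def)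
  next
    case False
    then have "1 < \<alpha> i" using tail i by simp
    then have "int p * int p dvd int p ^ \<alpha> i"
      by (metis Suc_leI le_imp_power_dvd numeral_2_eq_2 One_nat_def power2_eq_square)
    moreover have "int p * x i mod int (p ^ \<alpha> i) = 0"
      using fun_cong[OF ord, of i] i by (simp add: nat_pow_abelian_p_group one_abelian_p_group)
    ultimately have "int p * int p dvd int p * x i"
      by (metis dvd_trans mod_0_imp_dvd of_nat_power)
    then show ?thesis
      using assms(1) by (simp only: dvd_mult_cancel_left) simp
  qed
  have "?y \<in> carrier (abelian_p_group p k \<alpha>)"
  proof -
    \<comment> \<open>Division by \<open>p\<close> does not increase a nonnegative representative,
      so it stays in range.\<close>
    have "x i div int p < int p ^ \<alpha> i" if "0 \<le> x i" "x i < int p ^ \<alpha> i" for i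
      using that assms(1) zdiv_mono2[of "x i" 1 "int p"] by simp
    then show ?thesis
      using xc assms(1) by (auto simp: carrier_abelian_p_group PiE_iff pos_imp_zdiv_nonneg_iff)
  qed
  moreover have "?y [^]\<^bsub>abelian_p_group p k \<alpha>\<^esub> p = x"
  proof (rule ext)
    fix i
    \<comment> \<open>Inside the index range, multiplying back gives \<open>x i\<close>, which is
      already reduced; outside it both sides are \<open>undefined\<close>.\<close>
    show "(?y [^]\<^bsub>abelian_p_group p k \<alpha>\<^esub> p) i = x i"
      using xc dvd[of i] by (cases "i \<in> {1..k}") (auto simp: nat_pow_abelian_p_group PiE_iff extensional_def)
  qed
  ultimately show ?thesis by blast
qed

lemma isolated_subgroups_abelian_p_group:
  assumes "Factorial_Ring.prime p" "r \<le> k"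
    and "\<And>i. i \<in> {1..r} \<Longrightarrow> \<alpha> i = 1" "\<And>i. r < i \<Longrightarrow> i \<le> k \<Longrightarrow> 1 < \<alpha> i"
  shows "{H. isolated_subgroup H (abelian_p_group p k \<alpha>)} =
    {carrier (abelian_p_group p k \<alpha>)} \<union>
    {H. subgroup H (abelian_p_group p k \<alpha>) \<and>
        H \<inter> tail_factor p k \<alpha> r = {\<one>\<^bsub>abelian_p_group p k \<alpha>\<^esub>}}"
proof (rule comm_group.isolated_subgroups_eq[OF comm_group_abelian_p_group assms(1)])
  show "subgroup (tail_factor p k \<alpha> r) (abelian_p_group p k \<alpha>)"
    using assms(2) by (rule subgroup_tail_factor)
qed (use assms(2-) prime_gt_0_nat[OF assms(1)] in
  \<open>blast intro: exponent_abelian_p_group pow_mem_tail_factor tail_factor_root\<close>)+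

theorem theorem2p5:
  fixes p k :: nat and \<alpha> :: "nat \<Rightarrow> nat"
  assumes "Factorial_Ring.prime p"
    and "k \<ge> 1"
    and "1 \<le> \<alpha> 1"
    and "\<And>i j. 1 \<le> i \<Longrightarrow> i \<le> j \<Longrightarrow> j \<le> k \<Longrightarrow> \<alpha> i \<le> \<alpha> j"
  shows "(\<alpha> 1 > 1 \<longrightarrow>
            {H. isolated_subgroup H (abelian_p_group p k \<alpha>)} =
              {{\<one>\<^bsub>abelian_p_group p k \<alpha>\<^esub>}, carrier (abelian_p_group p k \<alpha>)}) \<and>
         (\<forall>r. 1 \<le> r \<and> r \<le> k \<and> (\<forall>i\<in>{1..r}. \<alpha> i = 1) \<and> (r < k \<longrightarrow> \<alpha> r < \<alpha> (r + 1)) \<longrightarrow>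
            {H. isolated_subgroup H (abelian_p_group p k \<alpha>)} =
              {carrier (abelian_p_group p k \<alpha>)} \<union>
              {H. subgroup H (abelian_p_group p k \<alpha>) \<and>
                  H \<inter> tail_factor p k \<alpha> r = {\<one>\<^bsub>abelian_p_group p k \<alpha>\<^esub>}})"
proof (intro conjI impI allI)
  let ?G = "abelian_p_group p k \<alpha>"
  assume "\<alpha> 1 > 1"
  then have gt: "1 < \<alpha> i" if "0 < i" "i \<le> k" for i
    using assms(4)[of 1 i] that by simp
  have group: "group ?G"
    using comm_group_abelian_p_group by (rule comm_group.axioms(2))
  \<comment> \<open>For \<open>r = 0\<close> the range \<open>{1..r}\<close> is empty and the tail
    factor is the whole group, so trivial intersection means that \<open>H\<close> is
    trivial.\<close>
  have "H \<inter> tail_factor p k \<alpha> 0 = H" if "subgroup H ?G" for H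
    using subgroup.subset[OF that] by (auto simp: tail_factor_def)
  then have "{H. subgroup H ?G \<and> H \<inter> tail_factor p k \<alpha> 0 = {\<one>\<^bsub>?G\<^esub>}} = {{\<one>\<^bsub>?G\<^esub>}}"
    using group.triv_subgroup[OF group] by auto
  moreover have "{H. isolated_subgroup H ?G} =
      {carrier ?G} \<union> {H. subgroup H ?G \<and> H \<inter> tail_factor p k \<alpha> 0 = {\<one>\<^bsub>?G\<^esub>}}"
    using assms(1) gt by (intro isolated_subgroups_abelian_p_group) auto
  ultimately show "{H. isolated_subgroup H ?G} = {{\<one>\<^bsub>?G\<^esub>}, carrier ?G}"
    by auto
next
  fix r
  assume r: "1 \<le> r \<and> r \<le> k \<and> (\<forall>i\<in>{1..r}. \<alpha> i = 1) \<and> (r < k \<longrightarrow> \<alpha> r < \<alpha> (r + 1))"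
  \<comment> \<open>The exponents jump above \<open>\<alpha> r = 1\<close> at \<open>r + 1\<close>
    and stay there by monotonicity; for \<open>r = k\<close> the claim is vacuous.\<close>
  have "1 < \<alpha> i" if "r < i" "i \<le> k" for i
    using assms(4)[of "r + 1" i] that r by force
  then show "{H. isolated_subgroup H (abelian_p_group p k \<alpha>)} =
      {carrier (abelian_p_group p k \<alpha>)} \<union>
      {H. subgroup H (abelian_p_group p k \<alpha>) \<and>
          H \<inter> tail_factor p k \<alpha> r = {\<one>\<^bsub>abelian_p_group p k \<alpha>\<^esub>}}"
    using assms(1) r by (intro isolated_subgroups_abelian_p_group) auto
qed

end
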